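(* Suppose $x_*\in T^{-1}(0)$. Let $\{x_k\}$ be an iterative sequence generated by the Sublinear Contracting PPA (defined in the context). Then $$\|T_\lambda(x_{k+1})\|\le O(\tau_k^p)=O(1/k^p),\qquad \mathtt{Gap}(x_{k+1})\le O(\tau_k^p)=O(1/k^p).$$
   Context: $\mathcal H$ is a real Hilbert space with inner product $\langle\cdot,\cdot\rangle$ and norm $\|\cdot\|$. $T$ is a (set-valued) maximally monotone operator on $\mathcal H$ such that $T^{-1}(0)=\{x:0\in Tx\}$ is nonempty and bounded. For $\lambda>0$, $J_{\lambda T}=(I+\lambda T)^{-1}$ and $T_\lambda=\frac1\lambda(I-J_{\lambda T})$ is the (single-valued) Yosida regularization. For a fixed $D>0$ and the initial point $x_0$ of the iteration, $\mathtt{Gap}(x)=\sup_{\|y-x_0\|\le D}\langle x-y,T_\lambda(y)\rangle$. Sublinear Contracting PPA: given $\mu\in[0,1)$, $p\ge1$, $\tau_{-1}\in(0,1]$, $x_{-1}=x_0\in\mathcal H$, set for $k\ge0$ $$\tau_k=\frac{1}{ak+1}\quad\Big(0<a\le\frac{1-\mu}{p}\Big),\qquad v_k=\frac{1}{\tau_{k-1}}x_k-\frac{1-\tau_{k-1}}{\tau_{k-1}}x_{k-1}.$$ Given $\lambda>0$, $\beta\ge0$ and $\delta_k\ge0$ with $\sum_{k\ge0}\delta_k<+\infty$, for $k=0,1,\dots$ find $x_{k+1}$ such that $$0=\frac{1}{\tau_k^p}T_\lambda(x_{k+1})-\frac{1-\tau_k}{\tau_k^p}T_\lambda(x_k)+(v_{k+1}-v_k)+\beta(x_{k+1}-x_k)+g_k,$$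 where $g_k\in\mathcal H$ satisfies $\|g_k\|\le\delta_k$. "$u_k\le O(r_k)$" means there is a constant $C$ independent of $k$ with $u_k\le Cr_k$ for all $k$ (for all $k\ge1$ when $r_k=1/k^p$). *)

theory Defs
  imports "HOL-Analysis.Analysis"
begin

definition monotone_operator :: "('a::real_inner \<Rightarrow> 'a set) \<Rightarrow> bool" where
  "monotone_operator T \<longleftrightarrow> (\<forall>x y. \<forall>u\<in>T x. \<forall>w\<in>T y. 0 \<le> (x - y) \<bullet> (u - w))"

definition maximally_monotone :: "('a::real_inner \<Rightarrow> 'a set) \<Rightarrow> bool" where
  "maximally_monotone T \<longleftrightarrow> monotone_operator T \<and>
     (\<forall>S. monotone_operator S \<and> (\<forall>x. T x \<subseteq> S x) \<longrightarrow> S = T)"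

definition operator_inverse :: "('a \<Rightarrow> 'b set) \<Rightarrow> 'b \<Rightarrow> 'a set" where
  "operator_inverse T y = {x. y \<in> T x}"

text \<open>The set-valued inverse of \<open>I + lam T\<close> is everywhere a singleton when \<open>T\<close> is maximally
  monotone on a Hilbert space and \<open>lam > 0\<close> (Minty); \<open>the_elem\<close> extracts its element.\<close>

definition resolvent :: "real \<Rightarrow> ('a::real_inner \<Rightarrow> 'a set) \<Rightarrow> 'a \<Rightarrow> 'a" where
  "resolvent lam T x = the_elem (operator_inverse (\<lambda>z. {z + lam *\<^sub>R u |u. u \<in> T z}) x)"

definition yosida :: "real \<Rightarrow> ('a::real_inner \<Rightarrow> 'a set) \<Rightarrow> 'a \<Rightarrow> 'a" where
  "yosida lam T x = (1 / lam) *\<^sub>R (x - resolvent lam T x)"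

text \<open>Valued in the extended reals, so that the supremum is meaningful without a separate
  boundedness argument.\<close>

definition gap :: "real \<Rightarrow> ('a::real_inner \<Rightarrow> 'a set) \<Rightarrow> 'a \<Rightarrow> real \<Rightarrow> 'a \<Rightarrow> ereal" where
  "gap lam T x0 D x = (SUP y\<in>{y. norm (y - x0) \<le> D}. ereal ((x - y) \<bullet> yosida lam T y))"

definition ppa_tau :: "real \<Rightarrow> nat \<Rightarrow> real" where
  "ppa_tau a k = 1 / (a * real k + 1)"

text \<open>The auxiliary sequence \<open>v\<close>. Sequences are indexed by \<open>nat\<close>, so the data with index \<open>-1\<close> are
  the separate arguments \<open>tau_init\<close> and \<open>x_init\<close>, which enter only through \<open>v\<close> at index \<open>0\<close>.\<close>

fun ppa_v :: "real \<Rightarrow> real \<Rightarrow> 'a::real_inner \<Rightarrow> (nat \<Rightarrow> 'a) \<Rightarrow> nat \<Rightarrow> 'a" where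
  "ppa_v a tau_init x_init x 0 =
     (1 / tau_init) *\<^sub>R x 0 - ((1 - tau_init) / tau_init) *\<^sub>R x_init"
| "ppa_v a tau_init x_init x (Suc k) =
     (1 / ppa_tau a k) *\<^sub>R x (Suc k) - ((1 - ppa_tau a k) / ppa_tau a k) *\<^sub>R x k"

end

theory Submission
  imports Defs
begin

text \<open>
  Write \<open>A\<close> for the Yosida regularization, \<open>c = a k + 1\<close> for the reciprocal of \<open>\<tau>\<^sub>k\<close>, and \<open>z\<close> for a
  zero of \<open>T\<close>. The convergence argument rests on two properties of \<open>A\<close>: it is monotone and it
  vanishes at \<open>z\<close>. That the resolvent, and with it \<open>A\<close>, is meaningful at every point is Minty's
  theorem (\<open>minty\<close>), which is proved here by minimizing the Fitzpatrick function of \<open>T\<close> plus half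
  the squared norm over \<open>H \<times> H\<close>. This objective is strongly convex, so minimizing sequences are
  Cauchy and completeness provides a minimizer.

  The iteration is analysed in two rounds. The first shows that the iterates stay bounded. Pairing
  the update with \<open>v\<^sub>k\<^sub>+\<^sub>1 - z\<close> shows that the energy
  \<open>|v\<^sub>k - z|\<^sup>2/2 + \<beta> |x\<^sub>k - z|\<^sup>2/2 + W\<^sub>k \<langle>A x\<^sub>k, x\<^sub>k - z\<rangle>\<close>, with \<open>W\<^sub>k\<close> the coefficient of \<open>A x\<^sub>k\<close> in
  the previous update, can only grow by \<open>|g\<^sub>k| |v\<^sub>k\<^sub>+\<^sub>1 - z|\<close> (\<open>energy_step\<close>). As \<open>\<Sum> |g\<^sub>k|\<close>
  converges, the sequence \<open>v\<^sub>k\<close> is bounded, and so is \<open>x\<^sub>k\<close>, since \<open>x\<^sub>k\<^sub>+\<^sub>1\<close> is a convex combination of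
  \<open>v\<^sub>k\<^sub>+\<^sub>1\<close> and \<open>x\<^sub>k\<close>.

  Through the cocoercivity of \<open>A\<close>, bounded energy only gives half of the desired exponent for
  \<open>|A x\<^sub>k|\<close>. The second round
  therefore reads the update as a linear recursion for \<open>W\<^sub>k A x\<^sub>k\<close>. Put
  \<open>S\<^sub>k = (v\<^sub>k - z) + \<beta> (x\<^sub>k - z) + \<Sum>\<^sub>i\<^sub><\<^sub>k g\<^sub>i\<close>, which is bounded by the first round. The update says
  \<open>W\<^sub>k\<^sub>+\<^sub>1 A x\<^sub>k\<^sub>+\<^sub>1 + S\<^sub>k\<^sub>+\<^sub>1 = \<theta> (W\<^sub>k A x\<^sub>k + S\<^sub>k) + (1 - \<theta>) S\<^sub>k\<close> for some \<open>\<theta>\<close> in \<open>[0, 1]\<close>, so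
  \<open>W\<^sub>k A x\<^sub>k + S\<^sub>k\<close> never leaves the ball that contains all \<open>S\<^sub>k\<close>, and \<open>W\<^sub>k A x\<^sub>k\<close> is bounded
  (\<open>residual_rate\<close>). Both rounds need \<open>(1 - 1/c) W\<^sub>k\<^sub>+\<^sub>1 \<le> W\<^sub>k\<close>; this is the tangent
  inequality for \<open>t \<mapsto> t\<^sup>p\<close> and the only place where \<open>p a \<le> 1\<close> enters.

  Finally the gap is at most the residual times a bounded distance, by monotonicity (\<open>gap_le\<close>).
\<close>

section \<open>Minty's theorem\<close>

text \<open>
  The set \<open>E\<close> is the epigraph of the supremum of the affine functions \<open>z \<mapsto> z \<bullet> w - c\<close>; working with
  the epigraph avoids infinite values of that supremum. Minimize \<open>t + |z|\<^sup>2/2\<close> over \<open>E\<close>. By the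
  parallelogram law two nearly optimal points are close, hence a minimizing sequence is Cauchy and
  its limit is a minimizer. The inequality in the conclusion is the first-order optimality
  condition: \<open>- z\<close> is a subgradient of the supremum at \<open>z\<close>.
\<close>

lemma regularized_support_minimizer:
  fixes P :: "('b::{real_inner, complete_space} \<times> real) set"
  defines "E \<equiv> {(z, t). \<forall>(w, c)\<in>P. z \<bullet> w - c \<le> t}"
  assumes "E \<noteq> {}"
    and lower: "\<And>z t. (z, t) \<in> E \<Longrightarrow> l \<le> t + (norm z)\<^sup>2 / 2"
  shows "\<exists>z t. (z, t) \<in> E \<and> (\<forall>(z', t')\<in>E. t - z \<bullet> (z' - z) \<le> t')"
proof -
  define f :: "'b \<times> real \<Rightarrow> real" where "f = (\<lambda>(z, t). t + (norm z)\<^sup>2 / 2)"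
  define m where "m = Inf (f ` E)"
  have bdd: "bdd_below (f ` E)"
    using lower unfolding bdd_below_def f_def by (intro exI[of _ l]) auto
  have m_le: "m \<le> t + (norm z)\<^sup>2 / 2" if "(z, t) \<in> E" for z t
    using cInf_lower[OF imageI[OF that] bdd] by (simp add: m_def f_def)
  have convex: "((1 - s) *\<^sub>R z + s *\<^sub>R z', (1 - s) * t + s * t') \<in> E"
    if "(z, t) \<in> E" "(z', t') \<in> E" "0 \<le> s" "s \<le> 1" for z z' t t' s
  proof -
    have "((1 - s) *\<^sub>R z + s *\<^sub>R z') \<bullet> w - c \<le> (1 - s) * t + s * t'" if "(w, c) \<in> P" for w c
    proof -
      have "(1 - s) * (z \<bullet> w - c) + s * (z' \<bullet> w - c) \<le> (1 - s) * t + s * t'"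
        using that \<open>(z, t) \<in> E\<close> \<open>(z', t') \<in> E\<close> \<open>0 \<le> s\<close> \<open>s \<le> 1\<close>
        by (intro add_mono mult_left_mono) (auto simp: E_def)
      then show ?thesis by (simp add: inner_add_left algebra_simps)
    qed
    then show ?thesis by (auto simp: E_def)
  qed
  \<comment> \<open>Compare the infimum with the value at the midpoint; the parallelogram law leaves a surplus
      \<open>|z - z'|\<^sup>2/8\<close>.\<close>
  have spread: "(norm (z - z'))\<^sup>2 \<le> 4 * (t + (norm z)\<^sup>2 / 2 - m) + 4 * (t' + (norm z')\<^sup>2 / 2 - m)"
    if "(z, t) \<in> E" "(z', t') \<in> E" for z z' t t'
    using m_le[OF convex[OF that, of "1/2"]]
    by (simp add: power2_norm_eq_inner inner_add_left inner_add_right inner_diff_left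
        inner_diff_right inner_commute add_divide_distrib algebra_simps)
  have "\<exists>q\<in>E. f q < m + inverse (real (Suc n))" for n
    using cInf_lessD[of "f ` E" "m + inverse (real (Suc n))"] \<open>E \<noteq> {}\<close> by (auto simp: m_def)
  then obtain q where q: "\<And>n. q n \<in> E" "\<And>n. f (q n) < m + inverse (real (Suc n))"
    by metis
  define Z t where "Z n = fst (q n)" and "t n = snd (q n)" for n
  have ZE: "(Z n, t n) \<in> E" and Zm: "t n + (norm (Z n))\<^sup>2 / 2 < m + inverse (real (Suc n))" for n
    using q[of n] by (auto simp: Z_def t_def f_def split_beta)
  have gap_lim: "(\<lambda>n. t n + (norm (Z n))\<^sup>2 / 2) \<longlonglongrightarrow> m"
  proof (rule tendsto_sandwich[OF _ _ tendsto_const])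
    show "(\<lambda>n. m + inverse (real (Suc n))) \<longlonglongrightarrow> m"
      using LIMSEQ_inverse_real_of_nat_add .
    show "\<forall>\<^sub>F n in sequentially. m \<le> t n + (norm (Z n))\<^sup>2 / 2"
      using m_le ZE by auto
    show "\<forall>\<^sub>F n in sequentially. t n + (norm (Z n))\<^sup>2 / 2 \<le> m + inverse (real (Suc n))"
      using less_imp_le[OF Zm] by (intro always_eventually allI)
  qed
  have "Cauchy Z"
  proof (rule metric_CauchyI)
    fix e :: real assume "0 < e"
    then have "0 < e\<^sup>2 / 8" by simp
    then obtain N where N: "\<And>n. n \<ge> N \<Longrightarrow> t n + (norm (Z n))\<^sup>2 / 2 - m < e\<^sup>2 / 8"
      using LIMSEQ_D[OF gap_lim] by (metis abs_ge_self le_less_trans real_norm_def)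
    have "dist (Z i) (Z j) < e" if "i \<ge> N" "j \<ge> N" for i j
    proof -
      have "(norm (Z i - Z j))\<^sup>2 < 4 * (e\<^sup>2 / 8) + 4 * (e\<^sup>2 / 8)"
        by (intro le_less_trans[OF spread[OF ZE ZE]] add_strict_mono mult_strict_left_mono N that) auto
      then have "(norm (Z i - Z j))\<^sup>2 < e\<^sup>2" by simp
      then show ?thesis using \<open>0 < e\<close> power2_less_imp_less[of "norm (Z i - Z j)" e]
        by (simp add: dist_norm)
    qed
    then show "\<exists>M. \<forall>i\<ge>M. \<forall>j\<ge>M. dist (Z i) (Z j) < e" by blast
  qed
  then obtain z where z: "Z \<longlonglongrightarrow> z"
    using Cauchy_convergent convergent_def by blast
  define r where "r = m - (norm z)\<^sup>2 / 2"
  have "(\<lambda>n. (t n + (norm (Z n))\<^sup>2 / 2) - (norm (Z n))\<^sup>2 / 2) \<longlonglongrightarrow> r"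
    unfolding r_def by (intro tendsto_intros gap_lim z) simp
  then have tr: "t \<longlonglongrightarrow> r" by simp
  have "z \<bullet> w - c \<le> r" if "(w, c) \<in> P" for w c
  proof (rule tendsto_le[OF _ tr])
    show "(\<lambda>n. Z n \<bullet> w - c) \<longlonglongrightarrow> z \<bullet> w - c"
      by (intro tendsto_intros z)
    show "\<forall>\<^sub>F n in sequentially. Z n \<bullet> w - c \<le> t n"
      using ZE that by (intro always_eventually allI) (auto simp: E_def)
  qed simp
  then have zE: "(z, r) \<in> E" by (auto simp: E_def)
  have "r - z \<bullet> (z' - z) \<le> t'" if "(z', t') \<in> E" for z' t'
  proof -
    define b where "b = t' - r + z \<bullet> (z' - z)"
    define n where "n = (norm (z' - z))\<^sup>2 / 2"
    \<comment> \<open>Optimality against the point at parameter \<open>s\<close> on the segment towards \<open>(z', t')\<close>, divided by \<open>s\<close>.\<close>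
    have step: "0 \<le> b + s * n" if "0 < s" "s \<le> 1" for s
    proof -
      have "m \<le> ((1 - s) * r + s * t') + (norm ((1 - s) *\<^sub>R z + s *\<^sub>R z'))\<^sup>2 / 2"
        using m_le convex[OF zE \<open>(z', t') \<in> E\<close>] that by simp
      also have "(1 - s) *\<^sub>R z + s *\<^sub>R z' = z + s *\<^sub>R (z' - z)"
        by (simp add: algebra_simps)
      also have "(norm (z + s *\<^sub>R (z' - z)))\<^sup>2 / 2 = (norm z)\<^sup>2 / 2 + s * (z \<bullet> (z' - z)) + s\<^sup>2 * n"
        unfolding n_def power2_norm_eq_inner
        by (simp add: inner_add_left inner_add_right inner_commute power2_eq_square add_divide_distrib)
      finally have "0 \<le> s * (b + s * n)"
        by (simp add: r_def b_def algebra_simps power2_eq_square diff_divide_distrib)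
      then show ?thesis using that by (simp add: zero_le_mult_iff)
    qed
    have "0 \<le> b"
    proof (rule tendsto_lowerbound)
      show "((\<lambda>s. b + s * n) \<longlongrightarrow> b) (at_right 0)"
        by (auto intro!: tendsto_eq_intros)
      show "\<forall>\<^sub>F s in at_right 0. 0 \<le> b + s * n"
        unfolding eventually_at_right_field using step by (intro exI[of _ 1]) auto
    qed simp
    then show ?thesis by (simp add: b_def)
  qed
  with zE show ?thesis by blast
qed

text \<open>
  A pair that is monotonically related to the whole graph can be added to the graph without losing
  monotonicity, so maximality forces it to be there already. This is the form in which maximality
  is used and checked below.
\<close>

lemma maximally_monotone_iff:
  "maximally_monotone T \<longleftrightarrow> monotone_operator T \<and>
     (\<forall>x v. (\<forall>y. \<forall>u\<in>T y. 0 \<le> (x - y) \<bullet> (v - u)) \<longrightarrow> v \<in> T x)"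
proof
  assume max: "maximally_monotone T"
  then have mono: "monotone_operator T" by (simp add: maximally_monotone_def)
  have "v \<in> T x" if rel: "\<forall>y. \<forall>u\<in>T y. 0 \<le> (x - y) \<bullet> (v - u)" for x v
  proof -
    define S where "S = T(x := insert v (T x))"
    have rel': "0 \<le> (y - x) \<bullet> (u - v)" if "u \<in> T y" for y u
    proof -
      have "(y - x) \<bullet> (u - v) = (x - y) \<bullet> (v - u)"
        by (simp add: inner_diff_left inner_diff_right)
      then show ?thesis using rel that by simp
    qed
    have "monotone_operator S"
      using mono rel rel' unfolding monotone_operator_def S_def by (auto simp: inner_diff_right)
    moreover have "\<forall>y. T y \<subseteq> S y" by (auto simp: S_def)
    ultimately have "S = T" using max unfolding maximally_monotone_def by blast
    then show ?thesis unfolding S_def by (metis fun_upd_same insertI1)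
  qed
  with mono show "monotone_operator T \<and>
     (\<forall>x v. (\<forall>y. \<forall>u\<in>T y. 0 \<le> (x - y) \<bullet> (v - u)) \<longrightarrow> v \<in> T x)" by blast
next
  assume r: "monotone_operator T \<and>
     (\<forall>x v. (\<forall>y. \<forall>u\<in>T y. 0 \<le> (x - y) \<bullet> (v - u)) \<longrightarrow> v \<in> T x)"
  have "S = T" if S: "monotone_operator S" "\<forall>x. T x \<subseteq> S x" for S
  proof (rule ext, rule antisym)
    fix x
    show "S x \<subseteq> T x"
    proof
      fix v assume "v \<in> S x"
      then have "\<forall>y. \<forall>u\<in>T y. 0 \<le> (x - y) \<bullet> (v - u)"
        using S unfolding monotone_operator_def by blast
      then show "v \<in> T x" using r by blast
    qed
  qed (use S in auto)
  with r show "maximally_monotone T" by (auto simp: maximally_monotone_def)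
qed

text \<open>
  The slice of \<open>E\<close> above \<open>(x, v)\<close> consists of the upper bounds of the Fitzpatrick function
  \<open>F(x, v) = sup (\<langle>x, u\<rangle> + \<langle>v, y\<rangle> - \<langle>y, u\<rangle>)\<close>, the supremum being over the graph. Maximality gives
  \<open>\<langle>x, v\<rangle> \<le> F(x, v)\<close>, which bounds \<open>F + |.|\<^sup>2/2\<close> below by \<open>|x + v|\<^sup>2/2\<close>; on the graph
  \<open>F(y, u) = \<langle>y, u\<rangle>\<close>. At a minimizer \<open>(x, v)\<close> the optimality condition, tested against graph points,
  says that \<open>(- v, - x)\<close> is monotonically related to the graph with margin \<open>|x + v|\<^sup>2\<close>. Hence it lies
  in the graph, and testing it against itself gives \<open>x + v = 0\<close>.
\<close>

lemma minty_at_zero: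
  fixes T :: "'a::{real_inner, complete_space} \<Rightarrow> 'a set"
  assumes "maximally_monotone T"
  shows "\<exists>z. - z \<in> T z"
proof -
  have mono: "\<And>x y u w. u \<in> T x \<Longrightarrow> w \<in> T y \<Longrightarrow> 0 \<le> (x - y) \<bullet> (u - w)"
    and max: "\<And>x v. (\<And>y u. u \<in> T y \<Longrightarrow> 0 \<le> (x - y) \<bullet> (v - u)) \<Longrightarrow> v \<in> T x"
    using assms unfolding maximally_monotone_iff monotone_operator_def by blast+
  define P where "P = {((u, y), y \<bullet> u) |y u. u \<in> T y}"
  define E where "E = {(z, t). \<forall>(w, c)\<in>P. z \<bullet> w - c \<le> t}"
  have E_iff: "((x, v), t) \<in> E \<longleftrightarrow> (\<forall>y. \<forall>u\<in>T y. x \<bullet> u + v \<bullet> y - y \<bullet> u \<le> t)" for x v t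
    by (auto simp: E_def P_def)
  have expand: "(x - y) \<bullet> (v - u) = x \<bullet> v - (x \<bullet> u + v \<bullet> y - y \<bullet> u)" for x y u v :: 'a
    by (simp add: inner_diff_left inner_diff_right inner_commute)
  have graph: "((y, u), y \<bullet> u) \<in> E" if "u \<in> T y" for y u
    unfolding E_iff using mono[OF that] by (simp add: expand)
  have fitz: "x \<bullet> v \<le> t" if "((x, v), t) \<in> E" for x v t
  proof (rule ccontr)
    assume "\<not> x \<bullet> v \<le> t"
    with that have "v \<in> T x" by (intro max) (force simp: E_iff expand)
    with that have "x \<bullet> v + v \<bullet> x - x \<bullet> v \<le> t" unfolding E_iff by blast
    with \<open>\<not> x \<bullet> v \<le> t\<close> show False by (simp add: inner_commute)
  qed
  have square: "x \<bullet> v + ((norm x)\<^sup>2 + (norm v)\<^sup>2) / 2 = (norm (x + v))\<^sup>2 / 2" for x v :: 'a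
    by (simp add: power2_norm_eq_inner inner_add_left inner_add_right inner_commute field_simps)
  \<comment> \<open>If the graph were empty, every pair would be monotonically related to it.\<close>
  have "T \<noteq> (\<lambda>_. {})"
    using max[of 0 0] by auto
  then have nonempty: "E \<noteq> {}" using graph by fastforce
  have lower: "0 \<le> t + (norm q)\<^sup>2 / 2" if "(q, t) \<in> E" for q t
  proof -
    obtain x v where q: "q = (x, v)" by (cases q)
    have "0 \<le> x \<bullet> v + ((norm x)\<^sup>2 + (norm v)\<^sup>2) / 2" by (simp add: square)
    also have "\<dots> \<le> t + (norm q)\<^sup>2 / 2" using fitz that by (simp add: q norm_Pair)
    finally show ?thesis .
  qed
  have "\<exists>q t. (q, t) \<in> E \<and> (\<forall>(q', t')\<in>E. t - q \<bullet> (q' - q) \<le> t')"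
    unfolding E_def
    by (rule regularized_support_minimizer) (fact nonempty[unfolded E_def], fact lower[unfolded E_def])
  then obtain q t where q: "(q, t) \<in> E"
    and q_opt: "\<forall>(q', t')\<in>E. t - q \<bullet> (q' - q) \<le> t'" by (elim exE conjE)
  obtain x v where q_eq: "q = (x, v)" by (cases q)
  have xv: "((x, v), t) \<in> E" using q by (simp add: q_eq)
  have opt: "t - (x, v) \<bullet> (q' - (x, v)) \<le> t'" if "(q', t') \<in> E" for q' t'
    using bspec[OF q_opt that] by (simp add: q_eq)
  have key: "(norm (x + v))\<^sup>2 \<le> (- v - y) \<bullet> (- x - u)" if "u \<in> T y" for y u
    using opt[OF graph[OF that]] fitz[OF xv]
    by (simp add: power2_norm_eq_inner inner_add_left inner_add_right inner_diff_left
        inner_diff_right inner_commute)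
  have "- x \<in> T (- v)"
    using key by (intro max) (meson order_trans zero_le_power2)
  with key[OF this] have "x + v = 0" by simp
  then have "- v = x" by (metis minus_unique add.commute)
  with \<open>- x \<in> T (- v)\<close> show ?thesis by auto
qed

text \<open>
  The general case reduces to \<open>minty_at_zero\<close> because \<open>lam T - x\<close> is again maximally monotone.
\<close>

theorem minty:
  fixes T :: "'a::{real_inner, complete_space} \<Rightarrow> 'a set"
  assumes "maximally_monotone T" and "0 < lam"
  shows "\<exists>z. \<exists>u\<in>T z. x = z + lam *\<^sub>R u"
proof -
  define S where "S z = (\<lambda>u. lam *\<^sub>R u - x) ` T z" for z
  have S_diff: "(y - z) \<bullet> ((lam *\<^sub>R u - x) - (lam *\<^sub>R w - x)) = lam * ((y - z) \<bullet> (u - w))"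
    for y z u w by (simp add: inner_diff_right algebra_simps)
  have "maximally_monotone S"
    unfolding maximally_monotone_iff
  proof (intro conjI allI impI)
    have "0 \<le> lam * ((y - z) \<bullet> (u - w))" if "u \<in> T y" "w \<in> T z" for y z u w
      using assms that unfolding maximally_monotone_def monotone_operator_def by simp
    then show "monotone_operator S"
      unfolding monotone_operator_def S_def ball_simps S_diff by blast
  next
    fix z v assume rel: "\<forall>y. \<forall>u\<in>S y. 0 \<le> (z - y) \<bullet> (v - u)"
    define v' where "v' = (1 / lam) *\<^sub>R (v + x)"
    have v: "v = lam *\<^sub>R v' - x" using \<open>0 < lam\<close> by (simp add: v'_def)
    have "0 \<le> (z - y) \<bullet> (v' - u)" if "u \<in> T y" for y u
    proof -
      have "0 \<le> (z - y) \<bullet> ((lam *\<^sub>R v' - x) - (lam *\<^sub>R u - x))"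
        using rel that unfolding v S_def by blast
      then show ?thesis using \<open>0 < lam\<close> unfolding S_diff by (simp add: zero_le_mult_iff)
    qed
    then have "v' \<in> T z" using assms unfolding maximally_monotone_iff by blast
    then show "v \<in> S z" unfolding v S_def by blast
  qed
  then obtain z where "- z \<in> S z" using minty_at_zero by blast
  then obtain u where "u \<in> T z" "- z = lam *\<^sub>R u - x" by (auto simp: S_def)
  then have "x = z + lam *\<^sub>R u" by (simp add: algebra_simps)
  with \<open>u \<in> T z\<close> show ?thesis by blast
qed

section \<open>The Yosida regularization\<close>

text \<open>
  Monotonicity makes \<open>I + lam T\<close> injective: two preimages \<open>z\<close>, \<open>z'\<close> of one point would satisfy
  \<open>0 \<le> - lam |u - w|\<^sup>2\<close> for their values \<open>u \<in> T z\<close>, \<open>w \<in> T z'\<close>.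
\<close>

lemma resolvent_eqI:
  assumes "monotone_operator T" and "0 < lam" and "u \<in> T z"
  shows "resolvent lam T (z + lam *\<^sub>R u) = z"
proof -
  have "z' = z" if "w \<in> T z'" "z + lam *\<^sub>R u = z' + lam *\<^sub>R w" for z' w
  proof -
    have "z' - z = lam *\<^sub>R (u - w)" using that(2) by (simp add: algebra_simps)
    moreover have "0 \<le> (z' - z) \<bullet> (w - u)"
      using assms that(1) unfolding monotone_operator_def by blast
    moreover have "(lam *\<^sub>R (u - w)) \<bullet> (w - u) = - (lam * (norm (u - w))\<^sup>2)"
      by (simp add: power2_norm_eq_inner inner_diff_left inner_diff_right inner_commute algebra_simps)
    ultimately have "0 \<le> - (lam * (norm (u - w))\<^sup>2)" by simp
    then have "u - w = 0" using \<open>0 < lam\<close> by (simp add: mult_le_0_iff)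
    with \<open>z' - z = lam *\<^sub>R (u - w)\<close> show ?thesis by simp
  qed
  then have "operator_inverse (\<lambda>z. {z + lam *\<^sub>R u |u. u \<in> T z}) (z + lam *\<^sub>R u) = {z}"
    using \<open>u \<in> T z\<close> unfolding operator_inverse_def by blast
  then show ?thesis by (simp add: resolvent_def)
qed

lemma yosida_in_resolvent:
  fixes T :: "'a::{real_inner, complete_space} \<Rightarrow> 'a set"
  assumes "maximally_monotone T" and "0 < lam"
  shows "yosida lam T x \<in> T (resolvent lam T x)"
proof -
  obtain z u where "u \<in> T z" "x = z + lam *\<^sub>R u" using minty[OF assms] by blast
  moreover from this have "resolvent lam T x = z"
    using resolvent_eqI assms unfolding maximally_monotone_def by blast
  ultimately show ?thesis using \<open>0 < lam\<close> by (simp add: yosida_def)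
qed

lemma yosida_monotone:
  fixes T :: "'a::{real_inner, complete_space} \<Rightarrow> 'a set"
  assumes "maximally_monotone T" and "0 < lam"
  shows "0 \<le> (x - y) \<bullet> (yosida lam T x - yosida lam T y)"
proof -
  let ?J = "resolvent lam T" and ?A = "yosida lam T"
  have J: "x = ?J x + lam *\<^sub>R ?A x" for x
    using \<open>0 < lam\<close> by (simp add: yosida_def)
  have "x - y = (?J x - ?J y) + lam *\<^sub>R (?A x - ?A y)"
    by (subst J[of x], subst J[of y]) (simp add: algebra_simps)
  then have "(x - y) \<bullet> (?A x - ?A y)
      = (?J x - ?J y) \<bullet> (?A x - ?A y) + lam * (norm (?A x - ?A y))\<^sup>2"
    by (simp add: inner_add_left power2_norm_eq_inner)
  moreover have "0 \<le> (?J x - ?J y) \<bullet> (?A x - ?A y)"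
    using yosida_in_resolvent[OF assms] assms(1)
    unfolding maximally_monotone_def monotone_operator_def by blast
  ultimately show ?thesis using \<open>0 < lam\<close> by simp
qed

lemma yosida_zero:
  assumes "maximally_monotone T" and "0 < lam" and "z \<in> operator_inverse T 0"
  shows "yosida lam T z = 0"
  using resolvent_eqI[of T lam 0 z] assms
  by (simp add: yosida_def operator_inverse_def maximally_monotone_def)

section \<open>One-step estimates\<close>

text \<open>
  By the mean value theorem \<open>c\<^sup>p - (c - a)\<^sup>p\<close> is at most \<open>a p\<close> times the \<open>(p-1)\<close>-th power of \<open>c\<close>, and the
  factor \<open>a p\<close> is at most 1.
\<close>

lemma powr_tangent_below:
  fixes a c p :: real
  assumes "0 \<le> a" "a < c" "1 \<le> p" "p * a \<le> 1"
  shows "(1 - 1 / c) * c powr p \<le> (c - a) powr p"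
proof (cases "a = 0")
  case False
  have "\<exists>y. c - a < y \<and> y < c \<and> c powr p - (c - a) powr p = (c - (c - a)) * (p * y powr (p - 1))"
    using assms False by (intro MVT2) (auto intro!: derivative_eq_intros)
  then obtain y where y: "c - a < y" "y < c" "c powr p - (c - a) powr p = a * p * y powr (p - 1)"
    by auto
  have "a * p * y powr (p - 1) \<le> 1 * c powr (p - 1)"
    using assms y by (intro mult_mono powr_mono2) (auto simp: mult.commute)
  then have "c powr p - (c - a) powr p \<le> c powr (p - 1)" using y by simp
  then show ?thesis using assms by (simp add: powr_diff algebra_simps)
qed (use assms in \<open>simp add: algebra_simps\<close>)

text \<open>
  One update, tested with \<open>v' - z\<close>. Here \<open>u\<close> and \<open>y\<close> are the new and the old iterate, \<open>A\<close> and \<open>B\<close> the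
  operator values there. The operator part splits exactly into a multiple of
  \<open>\<langle>u - y, A - B\<rangle> \<ge> 0\<close> and the difference of the two weighted terms \<open>\<langle>A, u - z\<rangle>\<close> and
  \<open>\<langle>B, y - z\<rangle>\<close>; the parts from \<open>v' - v\<close> and from \<open>\<beta>\<close> telescope up to nonnegative squares.
\<close>

lemma energy_step:
  fixes u y v v' z A B g :: "'a::real_inner" and c w W \<beta> :: real
  assumes eq: "w *\<^sub>R A - ((1 - 1 / c) * w) *\<^sub>R B + (v' - v) + \<beta> *\<^sub>R (u - y) + g = 0"
    and v': "v' = u + (c - 1) *\<^sub>R (u - y)"
    and "1 \<le> c" "0 \<le> w" "0 \<le> \<beta>" and W: "(1 - 1 / c) * w \<le> W"
    and AB: "0 \<le> (u - y) \<bullet> (A - B)" and B: "0 \<le> B \<bullet> (y - z)"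
  shows "(norm (v' - z))\<^sup>2 / 2 + \<beta> / 2 * (norm (u - z))\<^sup>2 + w * (A \<bullet> (u - z))
    \<le> (norm (v - z))\<^sup>2 / 2 + \<beta> / 2 * (norm (y - z))\<^sup>2 + W * (B \<bullet> (y - z)) + norm g * norm (v' - z)"
proof -
  define d e \<rho> where "d = u - z" and "e = y - z" and "\<rho> = (1 - 1 / c) * w"
  have \<rho>: "\<rho> * c = (c - 1) * w" using \<open>1 \<le> c\<close> by (simp add: \<rho>_def field_simps)
  have uy: "u - y = d - e" by (simp add: d_def e_def)
  have vd: "v' - z = d + (c - 1) *\<^sub>R (d - e)" by (simp add: v' d_def e_def)
  have op: "(w *\<^sub>R A - \<rho> *\<^sub>R B) \<bullet> (v' - z)
      = w * (c - 1) * ((u - y) \<bullet> (A - B)) + w * (A \<bullet> d) - \<rho> * (B \<bullet> e)"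
  proof -
    have "(w *\<^sub>R A - \<rho> *\<^sub>R B) \<bullet> (v' - z)
      = w * (c * (A \<bullet> d) - (c - 1) * (A \<bullet> e)) - (\<rho> * c) * (B \<bullet> d - B \<bullet> e) - \<rho> * (B \<bullet> e)"
      by (simp add: vd inner_add_left inner_add_right inner_diff_left inner_diff_right algebra_simps)
    then show ?thesis
      unfolding \<rho> uy by (simp add: inner_add_left inner_add_right inner_diff_left
          inner_diff_right inner_commute algebra_simps)
  qed
  have momentum: "(v' - v) \<bullet> (v' - z)
      = (norm (v' - z))\<^sup>2 / 2 - (norm (v - z))\<^sup>2 / 2 + (norm (v' - v))\<^sup>2 / 2"
    by (simp add: power2_norm_eq_inner inner_diff_left inner_diff_right inner_commute field_simps)
  have prox: "(u - y) \<bullet> (v' - z) = (norm d)\<^sup>2 / 2 - (norm e)\<^sup>2 / 2 + (c - 1 / 2) * (norm (u - y))\<^sup>2"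
    unfolding uy vd by (simp add: power2_norm_eq_inner inner_add_left inner_add_right
        inner_diff_left inner_diff_right inner_commute field_simps)
  have "0 = (w *\<^sub>R A - \<rho> *\<^sub>R B + (v' - v) + \<beta> *\<^sub>R (u - y) + g) \<bullet> (v' - z)"
    using eq by (simp add: \<rho>_def)
  then have "0 = (w *\<^sub>R A - \<rho> *\<^sub>R B) \<bullet> (v' - z) + (v' - v) \<bullet> (v' - z)
      + \<beta> * ((u - y) \<bullet> (v' - z)) + g \<bullet> (v' - z)"
    by (simp only: inner_add_left inner_scaleR_left)
  moreover have "- (g \<bullet> (v' - z)) \<le> norm g * norm (v' - z)"
    using Cauchy_Schwarz_ineq2[of g "v' - z"] by linarith
  moreover have "0 \<le> w * (c - 1) * ((u - y) \<bullet> (A - B))"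
    using AB \<open>0 \<le> w\<close> \<open>1 \<le> c\<close> by simp
  moreover have "\<rho> * (B \<bullet> e) \<le> W * (B \<bullet> e)"
    using W B by (intro mult_right_mono) (auto simp: \<rho>_def e_def)
  moreover have "\<beta> / 2 * (norm d)\<^sup>2 - \<beta> / 2 * (norm e)\<^sup>2 \<le> \<beta> * ((u - y) \<bullet> (v' - z))"
  proof -
    have "\<beta> * ((norm d)\<^sup>2 / 2 - (norm e)\<^sup>2 / 2) \<le> \<beta> * ((u - y) \<bullet> (v' - z))"
      unfolding prox using \<open>0 \<le> \<beta>\<close> \<open>1 \<le> c\<close> by (intro mult_left_mono) auto
    then show ?thesis by (simp add: right_diff_distrib)
  qed
  moreover have "0 \<le> (norm (v' - v))\<^sup>2" by simp
  ultimately show ?thesis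
    unfolding op momentum d_def[symmetric] e_def[symmetric] by linarith
qed

text \<open>
  A discrete Gronwall estimate in which the error is only linear in the new value: the recursion
  for the squares forces \<open>s (Suc k) \<le> s k + 2 * d k\<close>.
\<close>

lemma quadratic_recursion_bounded:
  fixes s d :: "nat \<Rightarrow> real"
  assumes rec: "\<And>k. (s (Suc k))\<^sup>2 \<le> (s k)\<^sup>2 + 2 * d k * s (Suc k)"
    and s: "\<And>k. 0 \<le> s k" and d: "\<And>k. 0 \<le> d k" and sum: "summable d"
  shows "s k \<le> s 0 + 2 * suminf d"
proof -
  have step: "s (Suc k) \<le> s k + 2 * d k" for k
  proof (rule ccontr)
    assume "\<not> s (Suc k) \<le> s k + 2 * d k"
    then have "s k < s (Suc k) - 2 * d k" and "s k < s (Suc k)" using d[of k] by auto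
    then have "s k * s k < s (Suc k) * (s (Suc k) - 2 * d k)"
      using s[of k] by (intro mult_strict_mono) auto
    then show False using rec[of k] by (simp add: power2_eq_square algebra_simps)
  qed
  have "s k \<le> s 0 + 2 * sum d {..<k}"
  proof (induction k)
    case (Suc k)
    then show ?case using step[of k] by simp
  qed simp
  moreover have "sum d {..<k} \<le> suminf d" using d sum by (intro sum_le_suminf) auto
  ultimately show ?thesis by linarith
qed

section \<open>Boundedness and decay along the iteration\<close>

locale contracting_ppa =
  fixes A :: "'a::real_inner \<Rightarrow> 'a" and z :: 'a
    and x v g :: "nat \<Rightarrow> 'a" and a p \<beta> :: real
  assumes A_mono: "0 \<le> (y - y') \<bullet> (A y - A y')" and A_zero: "A z = 0"
    and a: "0 < a" and p: "1 \<le> p" and pa: "p * a \<le> 1" and \<beta>: "0 \<le> \<beta>"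
    and g: "summable (\<lambda>k. norm (g k))"
    and v_0: "v 0 = x 0"
    and v_Suc: "v (Suc k) = x (Suc k) + (a * real k) *\<^sub>R (x (Suc k) - x k)"
    and iteration: "(a * real k + 1) powr p *\<^sub>R A (x (Suc k))
      - ((1 - 1 / (a * real k + 1)) * (a * real k + 1) powr p) *\<^sub>R A (x k)
      + (v (Suc k) - v k) + \<beta> *\<^sub>R (x (Suc k) - x k) + g k = 0"
begin

text \<open>
  The coefficient of \<open>A (x k)\<close> in the update that produced \<open>x k\<close>. No update produced \<open>x 0\<close>; the
  value 0 fits because the first update does not contain \<open>A (x 0)\<close>, its coefficient
  \<open>1 - 1 / (a * 0 + 1)\<close> being zero.
\<close>

definition weight :: "nat \<Rightarrow> real" where
  "weight k = (case k of 0 \<Rightarrow> 0 | Suc n \<Rightarrow> (a * real n + 1) powr p)"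

lemma weight_simps [simp]: "weight 0 = 0" "weight (Suc n) = (a * real n + 1) powr p"
  by (auto simp: weight_def)

lemma weight_nonneg: "0 \<le> weight k"
  by (cases k) auto

lemma weight_contraction: "(1 - 1 / (a * real k + 1)) * weight (Suc k) \<le> weight k"
proof (cases k)
  case (Suc n)
  have "(1 - 1 / (a * real k + 1)) * (a * real k + 1) powr p \<le> (a * real k + 1 - a) powr p"
    using a p pa Suc by (intro powr_tangent_below) (auto simp: algebra_simps add_pos_nonneg)
  also have "a * real k + 1 - a = a * real n + 1" by (simp add: Suc algebra_simps)
  finally show ?thesis by (simp add: Suc)
qed simp

lemma A_zero_mono: "0 \<le> A y \<bullet> (y - z)"
  using A_mono[of y z] by (simp add: A_zero inner_commute)

text \<open>
  The numbers \<open>sqrt (2 * \<Phi> k)\<close> of the energy \<open>\<Phi>\<close> dominate \<open>norm (v k - z)\<close>, so the growth in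
  \<open>energy_step\<close> is linear in them and the Gronwall estimate applies.
\<close>

lemma v_bounded: "\<exists>R. \<forall>k. norm (v k - z) \<le> R"
proof -
  define \<Phi> where "\<Phi> k = (norm (v k - z))\<^sup>2 / 2 + \<beta> / 2 * (norm (x k - z))\<^sup>2
    + weight k * (A (x k) \<bullet> (x k - z))" for k
  have v_le_\<Phi>: "(norm (v k - z))\<^sup>2 \<le> 2 * \<Phi> k" for k
  proof -
    have "0 \<le> \<beta> / 2 * (norm (x k - z))\<^sup>2" "0 \<le> weight k * (A (x k) \<bullet> (x k - z))"
      using \<beta> weight_nonneg A_zero_mono by auto
    then show ?thesis by (simp add: \<Phi>_def)
  qed
  then have \<Phi>_nonneg: "0 \<le> \<Phi> k" for k
    by (smt (verit) zero_le_power2)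
  have v_le: "norm (v k - z) \<le> sqrt (2 * \<Phi> k)" for k
    using v_le_\<Phi> by (intro real_le_rsqrt)
  have energy: "\<Phi> (Suc k) \<le> \<Phi> k + norm (g k) * norm (v (Suc k) - z)" for k
    unfolding \<Phi>_def weight_simps
    using iteration[of k] v_Suc[of k] a \<beta> weight_contraction[of k] A_mono A_zero_mono
    by (intro energy_step) auto
  have "(sqrt (2 * \<Phi> (Suc k)))\<^sup>2 \<le> (sqrt (2 * \<Phi> k))\<^sup>2 + 2 * norm (g k) * sqrt (2 * \<Phi> (Suc k))" for k
    using energy[of k] mult_left_mono[OF v_le[of "Suc k"] norm_ge_zero[of "g k"]] \<Phi>_nonneg
    by simp
  then have "sqrt (2 * \<Phi> k) \<le> sqrt (2 * \<Phi> 0) + 2 * (\<Sum>k. norm (g k))" for k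
    using g \<Phi>_nonneg by (intro quadratic_recursion_bounded) auto
  then show ?thesis using v_le order_trans by blast
qed

text \<open>
  With \<open>c = a * k + 1\<close> the definition of \<open>v\<close> says that \<open>x (Suc k)\<close> is the convex combination of
  \<open>v (Suc k)\<close> and \<open>x k\<close> with weights \<open>1 / c\<close> and \<open>1 - 1 / c\<close>.
\<close>

lemma x_bounded: "\<exists>R. \<forall>k. norm (x k - z) \<le> R"
proof -
  obtain R where R: "\<And>k. norm (v k - z) \<le> R" using v_bounded by blast
  have "norm (x k - z) \<le> R" for k
  proof (induction k)
    case 0
    then show ?case using R[of 0] by (simp add: v_0)
  next
    case (Suc k)
    define c where "c = a * real k + 1"
    have c: "1 \<le> c" using a by (simp add: c_def)
    have "v (Suc k) = x (Suc k) + (c - 1) *\<^sub>R (x (Suc k) - x k)" by (simp add: v_Suc c_def)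
    then have "c *\<^sub>R (x (Suc k) - z) = (v (Suc k) - z) + (c - 1) *\<^sub>R (x k - z)"
      by (simp add: algebra_simps)
    then have "norm (c *\<^sub>R (x (Suc k) - z)) \<le> norm (v (Suc k) - z) + norm ((c - 1) *\<^sub>R (x k - z))"
      by (metis norm_triangle_ineq)
    then have "c * norm (x (Suc k) - z) \<le> R + (c - 1) * R"
      using c R[of "Suc k"] mult_left_mono[OF Suc.IH, of "c - 1"] by simp
    then have "c * norm (x (Suc k) - z) \<le> c * R" by (simp add: algebra_simps)
    then show ?case using c by simp
  qed
  then show ?thesis by blast
qed

text \<open>
  The update moves \<open>weight k *\<^sub>R A (x k) + S k\<close> towards the bounded sequence \<open>S\<close>: the next
  value is a convex combination of it and \<open>S k\<close>. So it stays in any ball around 0 that contains \<open>S\<close>.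
\<close>

lemma residual_rate: "\<exists>C. \<forall>k. weight k * norm (A (x k)) \<le> C"
proof -
  obtain Rv Rx where Rv: "\<And>k. norm (v k - z) \<le> Rv" and Rx: "\<And>k. norm (x k - z) \<le> Rx"
    using v_bounded x_bounded by blast
  define S where "S k = (v k - z) + \<beta> *\<^sub>R (x k - z) + sum g {..<k}" for k
  define R where "R = Rv + \<beta> * Rx + (\<Sum>k. norm (g k))"
  have S: "norm (S k) \<le> R" for k
  proof -
    have "norm (sum g {..<k}) \<le> (\<Sum>k. norm (g k))"
      using g by (intro order_trans[OF norm_sum sum_le_suminf]) auto
    moreover have "norm (\<beta> *\<^sub>R (x k - z)) \<le> \<beta> * Rx" using Rx \<beta> by (simp add: mult_left_mono)
    ultimately show ?thesis unfolding S_def R_def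
      using Rv[of k] by (intro norm_triangle_le add_mono) auto
  qed
  define Y where "Y k = weight k *\<^sub>R A (x k) + S k" for k
  have Y: "norm (Y k) \<le> R" for k
  proof (induction k)
    case 0
    then show ?case using S[of 0] by (simp add: Y_def)
  next
    case (Suc k)
    define \<rho> where "\<rho> = (1 - 1 / (a * real k + 1)) * weight (Suc k)"
    \<comment> \<open>For \<open>k = 0\<close> both \<open>\<rho>\<close> and the weight vanish, and the quotient \<open>0 / 0 = 0\<close> is a valid \<open>\<theta>\<close>.\<close>
    define \<theta> where "\<theta> = \<rho> / weight k"
    have "0 \<le> a * real k" using a by simp
    then have "0 \<le> 1 - 1 / (a * real k + 1)" by (simp add: field_simps)
    then have \<rho>: "0 \<le> \<rho>" "\<rho> \<le> weight k"
      using weight_contraction[of k] unfolding \<rho>_def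
      by (auto simp del: weight_simps intro!: mult_nonneg_nonneg weight_nonneg)
    have \<theta>: "0 \<le> \<theta>" "\<theta> \<le> 1" "\<rho> = \<theta> * weight k"
      using \<rho> weight_nonneg[of k] by (auto simp: \<theta>_def divide_le_eq_1)
    have "Y (Suc k) = \<rho> *\<^sub>R A (x k) + S k"
      using iteration[of k] by (simp add: Y_def S_def \<rho>_def algebra_simps)
    also have "\<dots> = \<theta> *\<^sub>R Y k + (1 - \<theta>) *\<^sub>R S k"
      by (simp add: Y_def \<theta>(3) algebra_simps)
    also have "norm \<dots> \<le> \<theta> * R + (1 - \<theta>) * R"
      using \<theta> Suc.IH S[of k] by (intro norm_triangle_le add_mono) (auto intro: mult_left_mono)
    finally show ?case by (simp add: algebra_simps)
  qed
  have "weight k * norm (A (x k)) \<le> R + R" for k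
  proof -
    have "weight k * norm (A (x k)) = norm (Y k - S k)"
      using weight_nonneg[of k] by (simp add: Y_def)
    also have "\<dots> \<le> R + R" using Y[of k] S[of k] by (intro norm_triangle_le_diff) auto
    finally show ?thesis .
  qed
  then show ?thesis by blast
qed

end

section \<open>The gap function and the final rates\<close>

text \<open>
  Monotonicity moves the operator value from \<open>y\<close> to \<open>x\<close>, after which \<open>y\<close> enters only through its
  distance from \<open>x\<close>.
\<close>

lemma gap_le:
  assumes mono: "\<And>y. 0 \<le> (x - y) \<bullet> (yosida lam T x - yosida lam T y)"
  shows "gap lam T x0 D x \<le> ereal (norm (yosida lam T x) * (norm (x - x0) + D))"
  unfolding gap_def
proof (rule SUP_least)
  fix y assume "y \<in> {y. norm (y - x0) \<le> D}"
  then have y: "norm (y - x0) \<le> D" by simp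
  have "(x - y) \<bullet> yosida lam T y \<le> (x - y) \<bullet> yosida lam T x"
    using mono[of y] by (simp add: inner_diff_right)
  also have "\<dots> \<le> norm (yosida lam T x) * norm (x - y)"
    using norm_cauchy_schwarz[of "x - y" "yosida lam T x"] by (simp add: mult.commute)
  also have "norm (x - y) \<le> norm (x - x0) + D"
    using y norm_triangle_ineq4[of "x - x0" "y - x0"] by simp
  finally show "ereal ((x - y) \<bullet> yosida lam T y)
      \<le> ereal (norm (yosida lam T x) * (norm (x - x0) + D))"
    by (simp add: mult_left_mono)
qed

lemma ppa_tau_powr_le:
  assumes "0 < a" "0 \<le> p" "1 \<le> k"
  shows "ppa_tau a k powr p \<le> (1 / a) powr p * (1 / real k powr p)"
proof -
  have "0 < a * real k" using assms by simp
  then have "ppa_tau a k \<le> 1 / (a * real k)"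
    unfolding ppa_tau_def by (intro divide_left_mono mult_pos_pos[of "_ + _"]) auto
  then have "ppa_tau a k powr p \<le> (1 / (a * real k)) powr p"
    using assms by (intro powr_mono2) (auto simp: ppa_tau_def)
  also have "\<dots> = (1 / a) powr p * (1 / real k powr p)"
    using assms by (simp add: powr_divide powr_mult)
  finally show ?thesis .
qed

theorem theorem4:
  fixes T :: "'a::{real_inner, complete_space} \<Rightarrow> 'a set"
    and x g :: "nat \<Rightarrow> 'a" and \<delta> :: "nat \<Rightarrow> real"
    and x_init x_star :: 'a
    and lam D \<mu> p a tau_init \<beta> :: real
  assumes "maximally_monotone T"
    and "operator_inverse T 0 \<noteq> {}" and "bounded (operator_inverse T 0)"
    and "lam > 0" and "D > 0"
    and "0 \<le> \<mu>" and "\<mu> < 1" and "p \<ge> 1"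
    and "0 < a" and "a \<le> (1 - \<mu>) / p"
    and "0 < tau_init" and "tau_init \<le> 1" and "x_init = x 0"
    and "\<beta> \<ge> 0"
    and "\<And>k. \<delta> k \<ge> 0" and "summable \<delta>"
    and "\<And>k. norm (g k) \<le> \<delta> k"
    and "\<And>k. 0 = (1 / ppa_tau a k powr p) *\<^sub>R yosida lam T (x (Suc k))
               - ((1 - ppa_tau a k) / ppa_tau a k powr p) *\<^sub>R yosida lam T (x k)
               + (ppa_v a tau_init x_init x (Suc k) - ppa_v a tau_init x_init x k)
               + \<beta> *\<^sub>R (x (Suc k) - x k) + g k"
    and "x_star \<in> operator_inverse T 0"
  shows "(\<exists>C. \<forall>k. norm (yosida lam T (x (Suc k))) \<le> C * ppa_tau a k powr p)
       \<and> (\<exists>C. \<forall>k\<ge>1. norm (yosida lam T (x (Suc k))) \<le> C * (1 / real k powr p))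
       \<and> (\<exists>C. \<forall>k. gap lam T (x 0) D (x (Suc k)) \<le> ereal (C * ppa_tau a k powr p))
       \<and> (\<exists>C. \<forall>k\<ge>1. gap lam T (x 0) D (x (Suc k)) \<le> ereal (C * (1 / real k powr p)))"
proof -
  let ?A = "yosida lam T" and ?\<tau> = "ppa_tau a"
  note max = assms(1) and lam = assms(4)
  have a: "0 < a" and p: "1 \<le> p" using assms by auto
  have \<tau>: "0 < ?\<tau> k" "1 / ?\<tau> k = a * real k + 1" "1 - ?\<tau> k = 1 - 1 / (a * real k + 1)"
    "1 / ?\<tau> k powr p = (a * real k + 1) powr p" for k
    using a by (auto simp: ppa_tau_def powr_divide add_nonneg_pos)
  interpret contracting_ppa ?A x_star x "ppa_v a tau_init x_init x" g a p \<beta>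
  proof
    show "0 \<le> (y - y') \<bullet> (?A y - ?A y')" for y y'
      by (rule yosida_monotone[OF max lam])
    show "?A x_star = 0" by (rule yosida_zero) (use assms in auto)
    have "p * a \<le> 1 - \<mu>" using assms(10) p by (simp add: field_simps)
    then show "p * a \<le> 1" using assms(6) by linarith
    show "summable (\<lambda>k. norm (g k))"
      by (rule summable_comparison_test'[OF assms(16), of 0]) (simp add: assms(17))
    show "ppa_v a tau_init x_init x 0 = x 0"
      using assms(11,13) by (simp add: diff_divide_distrib algebra_simps)
    have ratio: "(1 - ?\<tau> k) / ?\<tau> k = a * real k" for k
      using \<tau>(1,2)[of k] by (simp add: diff_divide_distrib)
    show "ppa_v a tau_init x_init x (Suc k) = x (Suc k) + (a * real k) *\<^sub>R (x (Suc k) - x k)" for k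
      by (simp add: ratio \<tau>(2) algebra_simps)
    have "(1 - ?\<tau> k) / ?\<tau> k powr p = (1 - 1 / (a * real k + 1)) * (a * real k + 1) powr p" for k
      using \<tau>(3,4)[of k] by (metis mult.right_neutral times_divide_eq_right)
    then show "(a * real k + 1) powr p *\<^sub>R ?A (x (Suc k))
        - ((1 - 1 / (a * real k + 1)) * (a * real k + 1) powr p) *\<^sub>R ?A (x k)
        + (ppa_v a tau_init x_init x (Suc k) - ppa_v a tau_init x_init x k)
        + \<beta> *\<^sub>R (x (Suc k) - x k) + g k = 0" for k
      using assms(18)[of k] by (simp only: \<tau>(4))
  qed (use assms in auto)
  obtain C R where C: "\<And>k. weight k * norm (?A (x k)) \<le> C" and R: "\<And>k. norm (x k - x_star) \<le> R"
    using residual_rate x_bounded by blast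
  have res: "norm (?A (x (Suc k))) \<le> C * ?\<tau> k powr p" for k
  proof -
    have "0 < ?\<tau> k powr p" using \<tau>(1)[of k] by simp
    moreover have "1 / ?\<tau> k powr p * norm (?A (x (Suc k))) \<le> C"
      using C[of "Suc k"] by (simp only: weight_simps \<tau>(4))
    ultimately show ?thesis by (simp add: field_simps)
  qed
  \<comment> \<open>All iterates lie within \<open>R\<close> of \<open>x_star\<close>, hence within \<open>R + R\<close> of \<open>x 0\<close>.\<close>
  define C' where "C' = C * (R + R + D)"
  have gap: "gap lam T (x 0) D (x (Suc k)) \<le> ereal (C' * ?\<tau> k powr p)" for k
  proof -
    have "norm (x (Suc k) - x 0) \<le> R + R"
      using norm_triangle_ineq4[of "x (Suc k) - x_star" "x 0 - x_star"] R[of "Suc k"] R[of 0] by simp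
    then have bound: "norm (?A (x (Suc k))) * (norm (x (Suc k) - x 0) + D)
        \<le> (C * ?\<tau> k powr p) * (R + R + D)"
      using res[of k] assms(5) order_trans[OF norm_ge_zero res[of k]]
      by (intro mult_mono) auto
    have "gap lam T (x 0) D (x (Suc k))
        \<le> ereal (norm (?A (x (Suc k))) * (norm (x (Suc k) - x 0) + D))"
      by (rule gap_le) (rule yosida_monotone[OF max lam])
    also have "\<dots> \<le> ereal (C' * ?\<tau> k powr p)"
      using bound by (simp add: C'_def mult_ac)
    finally show ?thesis .
  qed
  have C_nonneg: "0 \<le> C" using C[of 0] by simp
  have "0 \<le> R" using R[of 0] norm_ge_zero order_trans by blast
  then have C'_nonneg: "0 \<le> C'" using C_nonneg assms(5) by (simp add: C'_def)
  have rate: "K * ?\<tau> k powr p \<le> (K * (1 / a) powr p) * (1 / real k powr p)"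
    if "0 \<le> K" "1 \<le> k" for K k
    using mult_left_mono[OF ppa_tau_powr_le[of a p k] that(1)] a p that(2) by (simp add: mult.assoc)
  show ?thesis
  proof (intro conjI)
    show "\<exists>C. \<forall>k. norm (?A (x (Suc k))) \<le> C * ?\<tau> k powr p"
      using res by blast
    show "\<exists>C. \<forall>k\<ge>1. norm (?A (x (Suc k))) \<le> C * (1 / real k powr p)"
      using order_trans[OF res rate[OF C_nonneg]] by blast
    show "\<exists>C. \<forall>k. gap lam T (x 0) D (x (Suc k)) \<le> ereal (C * ?\<tau> k powr p)"
      using gap by blast
    have "gap lam T (x 0) D (x (Suc k)) \<le> ereal ((C' * (1 / a) powr p) * (1 / real k powr p))"
      if "1 \<le> k" for k
      using gap[of k] rate[OF C'_nonneg that] ereal_less_eq(3) order_trans by blast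
    then show "\<exists>C. \<forall>k\<ge>1. gap lam T (x 0) D (x (Suc k)) \<le> ereal (C * (1 / real k powr p))"
      by blast
  qed
qed

end
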